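(* Let $\mathcal V$ be a variety of Heyting algebras having the Finite Model Property. If an existential first-order formula in the language $\{\mathbf 0,\mathbf 1,\vee,\wedge,\to\}$ with parameters in a finite $\mathcal V$-algebra $A$ is satisfied in some $\mathcal V$-algebra containing $A$, then it is satisfied in some finite $\mathcal V$-algebra containing $A$.
   Context: A variety $\mathcal V$ of Heyting algebras has the Finite Model Property if every equation failing in some algebra of $\mathcal V$ fails in some finite algebra of $\mathcal V$ (equivalently, $\mathcal V$ is generated by its finite members). A $\mathcal V$-algebra is a Heyting algebra in $\mathcal V$; "containing $A$" means as a Heyting subalgebra. *)

theory Defs
  imports "HOL-Algebra.Congruence"
begin

record 'a heyting = "'a partial_object" +
  hzero :: 'a
  hone :: 'a
  hjoin :: "'a \<Rightarrow> 'a \<Rightarrow> 'a" (infixl \<open>\<curlyvee>\<index>\<close> 65)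
  hmeet :: "'a \<Rightarrow> 'a \<Rightarrow> 'a" (infixl \<open>\<curlywedge>\<index>\<close> 70)
  himp :: "'a \<Rightarrow> 'a \<Rightarrow> 'a" (infixr \<open>\<Rrightarrow>\<index>\<close> 60)

text \<open>The lattice order \<open>x \<le> y\<close> is rendered as \<open>x \<curlywedge> y = x\<close>.
  The one-element algebra (\<open>hzero = hone\<close>) is a Heyting algebra.\<close>

locale heyting_algebra =
  fixes H :: "'a heyting" (structure)
  assumes zero_closed: "hzero H \<in> carrier H"
    and one_closed: "hone H \<in> carrier H"
    and join_closed: "\<lbrakk>x \<in> carrier H; y \<in> carrier H\<rbrakk> \<Longrightarrow> x \<curlyvee> y \<in> carrier H"
    and meet_closed: "\<lbrakk>x \<in> carrier H; y \<in> carrier H\<rbrakk> \<Longrightarrow> x \<curlywedge> y \<in> carrier H"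
    and imp_closed: "\<lbrakk>x \<in> carrier H; y \<in> carrier H\<rbrakk> \<Longrightarrow> x \<Rrightarrow> y \<in> carrier H"
    and join_assoc: "\<lbrakk>x \<in> carrier H; y \<in> carrier H; z \<in> carrier H\<rbrakk>
      \<Longrightarrow> (x \<curlyvee> y) \<curlyvee> z = x \<curlyvee> (y \<curlyvee> z)"
    and join_comm: "\<lbrakk>x \<in> carrier H; y \<in> carrier H\<rbrakk> \<Longrightarrow> x \<curlyvee> y = y \<curlyvee> x"
    and join_absorb: "\<lbrakk>x \<in> carrier H; y \<in> carrier H\<rbrakk> \<Longrightarrow> x \<curlyvee> (x \<curlywedge> y) = x"
    and meet_assoc: "\<lbrakk>x \<in> carrier H; y \<in> carrier H; z \<in> carrier H\<rbrakk>
      \<Longrightarrow> (x \<curlywedge> y) \<curlywedge> z = x \<curlywedge> (y \<curlywedge> z)"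
    and meet_comm: "\<lbrakk>x \<in> carrier H; y \<in> carrier H\<rbrakk> \<Longrightarrow> x \<curlywedge> y = y \<curlywedge> x"
    and meet_absorb: "\<lbrakk>x \<in> carrier H; y \<in> carrier H\<rbrakk> \<Longrightarrow> x \<curlywedge> (x \<curlyvee> y) = x"
    and zero_least: "x \<in> carrier H \<Longrightarrow> hzero H \<curlywedge> x = hzero H"
    and one_greatest: "x \<in> carrier H \<Longrightarrow> x \<curlywedge> hone H = x"
    and residuation: "\<lbrakk>x \<in> carrier H; y \<in> carrier H; z \<in> carrier H\<rbrakk>
      \<Longrightarrow> z \<curlywedge> (x \<Rrightarrow> y) = z \<longleftrightarrow> (z \<curlywedge> x) \<curlywedge> y = z \<curlywedge> x"

definition heyting_subalgebra :: "'a heyting \<Rightarrow> 'a heyting \<Rightarrow> bool" where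
  "heyting_subalgebra A B \<longleftrightarrow>
     heyting_algebra A \<and> heyting_algebra B \<and> carrier A \<subseteq> carrier B \<and>
     hzero A = hzero B \<and> hone A = hone B \<and>
     (\<forall>x\<in>carrier A. \<forall>y\<in>carrier A.
        x \<curlyvee>\<^bsub>A\<^esub> y = x \<curlyvee>\<^bsub>B\<^esub> y \<and>
        x \<curlywedge>\<^bsub>A\<^esub> y = x \<curlywedge>\<^bsub>B\<^esub> y \<and>
        x \<Rrightarrow>\<^bsub>A\<^esub> y = x \<Rrightarrow>\<^bsub>B\<^esub> y)"

datatype 'v ha_term =
    TVar 'v
  | TZero
  | TOne
  | TJoin "'v ha_term" "'v ha_term"
  | TMeet "'v ha_term" "'v ha_term"
  | TImp "'v ha_term" "'v ha_term"

primrec ha_eval :: "'a heyting \<Rightarrow> ('v \<Rightarrow> 'a) \<Rightarrow> 'v ha_term \<Rightarrow> 'a" where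
  "ha_eval H e (TVar v) = e v"
| "ha_eval H e TZero = hzero H"
| "ha_eval H e TOne = hone H"
| "ha_eval H e (TJoin s t) = ha_eval H e s \<curlyvee>\<^bsub>H\<^esub> ha_eval H e t"
| "ha_eval H e (TMeet s t) = ha_eval H e s \<curlywedge>\<^bsub>H\<^esub> ha_eval H e t"
| "ha_eval H e (TImp s t) = ha_eval H e s \<Rrightarrow>\<^bsub>H\<^esub> ha_eval H e t"

type_synonym ha_equation = "nat ha_term \<times> nat ha_term"

definition ha_satisfies_eq :: "'a heyting \<Rightarrow> ha_equation \<Rightarrow> bool" where
  "ha_satisfies_eq H q \<longleftrightarrow>
     (\<forall>e. range e \<subseteq> carrier H \<longrightarrow> ha_eval H e (fst q) = ha_eval H e (snd q))"

text \<open>A variety is an equational class. Its members are the algebras whose carrier is a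
  subset of the type \<open>'a\<close>, which plays the role of the universe of discourse. Whether an
  equation fails somewhere in an equational class is already decided by its countable members,
  so every infinite \<open>'a\<close> gives the same notion of finite model property.\<close>

definition heyting_variety :: "'a heyting set \<Rightarrow> bool" where
  "heyting_variety V \<longleftrightarrow>
     (\<exists>E. V = {H. heyting_algebra H \<and> (\<forall>q\<in>E. ha_satisfies_eq H q)})"

definition finite_model_property :: "'a heyting set \<Rightarrow> bool" where
  "finite_model_property V \<longleftrightarrow>
     (\<forall>q. (\<exists>H\<in>V. \<not> ha_satisfies_eq H q) \<longrightarrow>
          (\<exists>H\<in>V. finite (carrier H) \<and> \<not> ha_satisfies_eq H q))"

text \<open>First-order formulas with variables in \<open>nat\<close> and parameters in \<open>'a\<close>: in the atoms,
  \<open>Inl n\<close> is the variable number \<open>n\<close> and \<open>Inr a\<close> is the parameter \<open>a\<close>.\<close>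

datatype 'a ha_formula =
    FFalse
  | FEq "(nat + 'a) ha_term" "(nat + 'a) ha_term"
  | FNot "'a ha_formula"
  | FAnd "'a ha_formula" "'a ha_formula"
  | FOr "'a ha_formula" "'a ha_formula"
  | FImp "'a ha_formula" "'a ha_formula"
  | FEx nat "'a ha_formula"
  | FAll nat "'a ha_formula"

primrec ha_sat :: "'a heyting \<Rightarrow> (nat \<Rightarrow> 'a) \<Rightarrow> 'a ha_formula \<Rightarrow> bool" where
  "ha_sat H e FFalse \<longleftrightarrow> False"
| "ha_sat H e (FEq s t) \<longleftrightarrow> ha_eval H (case_sum e id) s = ha_eval H (case_sum e id) t"
| "ha_sat H e (FNot \<phi>) \<longleftrightarrow> \<not> ha_sat H e \<phi>"
| "ha_sat H e (FAnd \<phi> \<psi>) \<longleftrightarrow> ha_sat H e \<phi> \<and> ha_sat H e \<psi>"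
| "ha_sat H e (FOr \<phi> \<psi>) \<longleftrightarrow> ha_sat H e \<phi> \<or> ha_sat H e \<psi>"
| "ha_sat H e (FImp \<phi> \<psi>) \<longleftrightarrow> (ha_sat H e \<phi> \<longrightarrow> ha_sat H e \<psi>)"
| "ha_sat H e (FEx n \<phi>) \<longleftrightarrow> (\<exists>x\<in>carrier H. ha_sat H (e(n := x)) \<phi>)"
| "ha_sat H e (FAll n \<phi>) \<longleftrightarrow> (\<forall>x\<in>carrier H. ha_sat H (e(n := x)) \<phi>)"

text \<open>For a sentence this is truth in \<open>H\<close>; free variables may take any values in \<open>H\<close>.\<close>

definition ha_satisfied_in :: "'a heyting \<Rightarrow> 'a ha_formula \<Rightarrow> bool" where
  "ha_satisfied_in H \<phi> \<longleftrightarrow> (\<exists>e. range e \<subseteq> carrier H \<and> ha_sat H e \<phi>)"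

primrec quantifier_free :: "'a ha_formula \<Rightarrow> bool" where
  "quantifier_free FFalse \<longleftrightarrow> True"
| "quantifier_free (FEq s t) \<longleftrightarrow> True"
| "quantifier_free (FNot \<phi>) \<longleftrightarrow> quantifier_free \<phi>"
| "quantifier_free (FAnd \<phi> \<psi>) \<longleftrightarrow> quantifier_free \<phi> \<and> quantifier_free \<psi>"
| "quantifier_free (FOr \<phi> \<psi>) \<longleftrightarrow> quantifier_free \<phi> \<and> quantifier_free \<psi>"
| "quantifier_free (FImp \<phi> \<psi>) \<longleftrightarrow> quantifier_free \<phi> \<and> quantifier_free \<psi>"
| "quantifier_free (FEx n \<phi>) \<longleftrightarrow> False"
| "quantifier_free (FAll n \<phi>) \<longleftrightarrow> False"

inductive existential_formula :: "'a ha_formula \<Rightarrow> bool" where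
  "quantifier_free \<phi> \<Longrightarrow> existential_formula \<phi>"
| "existential_formula \<phi> \<Longrightarrow> existential_formula (FEx n \<phi>)"

text \<open>The BNF set function of the datatype collects exactly the parameters of a formula.\<close>

abbreviation parameters :: "'a ha_formula \<Rightarrow> 'a set" where
  "parameters \<equiv> set_ha_formula"

end

theory Submission
  imports Defs "HOL-Library.FuncSet"
begin

text \<open>Satisfying an existential formula in an extension of \<open>A\<close> amounts to realising a finite
  pattern of true and false equations: those of the quantifier-free matrix together with the
  diagram of \<open>A\<close>. The true equations are summarised by one term \<open>t\<close>, the meet of their
  biimplications. For a false equation \<open>p = q\<close>, the equation \<open>p \<curlywedge> t = q \<curlywedge> t\<close> fails in the given
  algebra, hence in a finite member of the variety; there, the quotient by the filter generated
  by the value \<open>u\<close> of \<open>t\<close>, realised as the interval below \<open>u\<close>, makes all the true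
  equations hold and \<open>p = q\<close> fail. The product of these finitely many finite quotients
  realises the whole pattern, and it contains a copy of \<open>A\<close> because it satisfies its diagram.\<close>

subsection \<open>Heyting algebras\<close>

context heyting_algebra
begin

section \<open>The lattice order\<close>

lemmas closed = zero_closed one_closed join_closed meet_closed imp_closed

abbreviation le :: "'a \<Rightarrow> 'a \<Rightarrow> bool" (infix \<open>\<sqsubseteq>\<close> 50) where
  "x \<sqsubseteq> y \<equiv> x \<curlywedge> y = x"

lemma meet_idem: "x \<in> carrier H \<Longrightarrow> x \<curlywedge> x = x"
  by (metis join_absorb meet_absorb meet_closed)

lemma le_trans:
  "\<lbrakk>x \<in> carrier H; y \<in> carrier H; z \<in> carrier H; x \<sqsubseteq> y; y \<sqsubseteq> z\<rbrakk> \<Longrightarrow> x \<sqsubseteq> z"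
  by (metis meet_assoc)

lemma le_antisym: "\<lbrakk>x \<in> carrier H; y \<in> carrier H; x \<sqsubseteq> y; y \<sqsubseteq> x\<rbrakk> \<Longrightarrow> x = y"
  by (metis meet_comm)

lemma le_join_iff:
  "\<lbrakk>x \<in> carrier H; y \<in> carrier H\<rbrakk> \<Longrightarrow> x \<sqsubseteq> y \<longleftrightarrow> x \<curlyvee> y = y"
  by (metis join_absorb join_comm meet_absorb meet_comm)

lemma le_meet_iff:
  assumes "x \<in> carrier H" "y \<in> carrier H" "z \<in> carrier H"
  shows "z \<sqsubseteq> x \<curlywedge> y \<longleftrightarrow> z \<sqsubseteq> x \<and> z \<sqsubseteq> y"
proof
  assume "z \<sqsubseteq> x \<curlywedge> y"
  then show "z \<sqsubseteq> x \<and> z \<sqsubseteq> y"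
    using assms by (metis meet_assoc meet_closed meet_comm meet_idem)
next
  assume "z \<sqsubseteq> x \<and> z \<sqsubseteq> y"
  then show "z \<sqsubseteq> x \<curlywedge> y"
    using assms by (metis meet_assoc)
qed

lemma join_le_iff:
  assumes "x \<in> carrier H" "y \<in> carrier H" "z \<in> carrier H"
  shows "x \<curlyvee> y \<sqsubseteq> z \<longleftrightarrow> x \<sqsubseteq> z \<and> y \<sqsubseteq> z"
proof
  assume "x \<curlyvee> y \<sqsubseteq> z"
  moreover have "x \<sqsubseteq> x \<curlyvee> y" "y \<sqsubseteq> x \<curlyvee> y"
    using assms by (metis meet_absorb join_comm)+
  ultimately show "x \<sqsubseteq> z \<and> y \<sqsubseteq> z"
    using assms by (meson le_trans join_closed)
next
  assume "x \<sqsubseteq> z \<and> y \<sqsubseteq> z"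
  then show "x \<curlyvee> y \<sqsubseteq> z"
    using assms by (metis le_join_iff join_assoc join_closed)
qed

lemma le_refl: "x \<in> carrier H \<Longrightarrow> x \<sqsubseteq> x"
  by (rule meet_idem)

text \<open>Take z to be x, then y, and use antisymmetry. This lets meets and implications be
  compared through the elements below them, where \<open>le_meet_iff\<close> and
  \<open>residuation\<close> apply.\<close>

lemma le_indirect:
  assumes "x \<in> carrier H" "y \<in> carrier H" "\<And>z. z \<in> carrier H \<Longrightarrow> z \<sqsubseteq> x \<longleftrightarrow> z \<sqsubseteq> y"
  shows "x = y"
  using assms by (meson le_antisym le_refl)

section \<open>Relativisation below an element u\<close>

text \<open>The inequality from left to right rests on residuation: u is moved across into an
  implication, so that x and y, and hence their join, can be bounded without it. The reverse
  inequality holds in every lattice.\<close>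

lemma meet_join_distrib:
  assumes c: "x \<in> carrier H" "y \<in> carrier H" "u \<in> carrier H"
  shows "(x \<curlyvee> y) \<curlywedge> u = (x \<curlywedge> u) \<curlyvee> (y \<curlywedge> u)" (is "?L = ?R")
proof (rule le_antisym)
  have R: "?R \<in> carrier H" using c by (simp add: closed)
  have "x \<curlywedge> u \<sqsubseteq> ?R \<and> y \<curlywedge> u \<sqsubseteq> ?R"
    using c R join_le_iff[of "x \<curlywedge> u" "y \<curlywedge> u" ?R] le_refl[OF R] by (simp add: closed)
  then have "x \<sqsubseteq> u \<Rrightarrow> ?R \<and> y \<sqsubseteq> u \<Rrightarrow> ?R"
    using c R by (simp add: residuation)
  then have "x \<curlyvee> y \<sqsubseteq> u \<Rrightarrow> ?R"
    using c R by (simp add: join_le_iff closed)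
  then show "?L \<sqsubseteq> ?R"
    using c R by (simp add: residuation closed)
  have "x \<sqsubseteq> x \<curlyvee> y" "y \<sqsubseteq> x \<curlyvee> y"
    using c by (metis meet_absorb join_comm)+
  moreover have "x \<curlywedge> u \<sqsubseteq> x" "x \<curlywedge> u \<sqsubseteq> u" "y \<curlywedge> u \<sqsubseteq> y" "y \<curlywedge> u \<sqsubseteq> u"
    using c by (meson le_meet_iff le_refl meet_closed)+
  ultimately have "x \<curlywedge> u \<sqsubseteq> x \<curlyvee> y" "y \<curlywedge> u \<sqsubseteq> x \<curlyvee> y"
    using c by (meson le_trans closed)+
  then show "?R \<sqsubseteq> ?L"
    using c \<open>x \<curlywedge> u \<sqsubseteq> u\<close> \<open>y \<curlywedge> u \<sqsubseteq> u\<close> by (simp add: join_le_iff le_meet_iff closed)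
qed (use c in \<open>simp_all add: closed\<close>)

lemma meet_meet_distrib:
  assumes c: "x \<in> carrier H" "y \<in> carrier H" "u \<in> carrier H"
  shows "(x \<curlywedge> y) \<curlywedge> u = (x \<curlywedge> u) \<curlywedge> (y \<curlywedge> u)"
  by (rule le_indirect) (use c in \<open>auto simp: le_meet_iff closed\<close>)

text \<open>Both sides lie below u, so only elements z below u have to be compared. For them
  residuation reduces both sides to the same condition, because meeting with u changes nothing below
  u.\<close>

lemma imp_meet_relative:
  assumes c: "x \<in> carrier H" "y \<in> carrier H" "u \<in> carrier H"
  shows "(x \<Rrightarrow> y) \<curlywedge> u = ((x \<curlywedge> u) \<Rrightarrow> (y \<curlywedge> u)) \<curlywedge> u"
proof (rule le_indirect)
  fix z assume z: "z \<in> carrier H"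
  have "z \<curlywedge> x \<sqsubseteq> y \<longleftrightarrow> z \<curlywedge> (x \<curlywedge> u) \<sqsubseteq> y \<curlywedge> u" if zu: "z \<sqsubseteq> u"
  proof -
    have "z \<curlywedge> (x \<curlywedge> u) = z \<curlywedge> x"
      using c z zu by (metis meet_assoc meet_comm)
    moreover have "z \<curlywedge> x \<sqsubseteq> u"
      using c z zu by (metis meet_assoc meet_comm)
    ultimately show ?thesis
      using c z by (simp add: le_meet_iff closed)
  qed
  then show "z \<sqsubseteq> (x \<Rrightarrow> y) \<curlywedge> u \<longleftrightarrow> z \<sqsubseteq> ((x \<curlywedge> u) \<Rrightarrow> (y \<curlywedge> u)) \<curlywedge> u"
    using c z by (auto simp: le_meet_iff residuation closed)
qed (use c in \<open>simp_all add: closed\<close>)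

lemma imp_eq_one_iff:
  "\<lbrakk>x \<in> carrier H; y \<in> carrier H\<rbrakk> \<Longrightarrow> x \<Rrightarrow> y = hone H \<longleftrightarrow> x \<sqsubseteq> y"
  by (metis imp_closed meet_comm one_closed one_greatest residuation)

text \<open>Elements whose biimplication lies in the filter generated by u are congruent modulo that
  filter; \<open>x \<curlywedge> u\<close> is the representative of the class of x.\<close>

lemma le_biimp_imp_meet_eq:
  assumes c: "x \<in> carrier H" "y \<in> carrier H" "u \<in> carrier H"
    and u: "u \<sqsubseteq> (x \<Rrightarrow> y) \<curlywedge> (y \<Rrightarrow> x)"
  shows "x \<curlywedge> u = y \<curlywedge> u"
proof -
  have "u \<curlywedge> x \<sqsubseteq> y" "u \<curlywedge> y \<sqsubseteq> x"
    using c u by (simp_all add: le_meet_iff residuation closed)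
  moreover have "u \<curlywedge> x \<sqsubseteq> u" "u \<curlywedge> y \<sqsubseteq> u"
    using c by (metis meet_assoc meet_comm meet_idem)+
  ultimately have "u \<curlywedge> x \<sqsubseteq> u \<curlywedge> y" "u \<curlywedge> y \<sqsubseteq> u \<curlywedge> x"
    using c by (simp_all add: le_meet_iff closed)
  then have "u \<curlywedge> x = u \<curlywedge> y"
    using c le_antisym[of "u \<curlywedge> x" "u \<curlywedge> y"] by (simp add: closed)
  then show ?thesis using c by (simp add: meet_comm)
qed

lemma eval_closed:
  "e ` set_ha_term t \<subseteq> carrier H \<Longrightarrow> ha_eval H e t \<in> carrier H"
  by (induction t) (auto simp: closed image_Un)

end

lemma ha_eval_cong:
  "(\<And>v. v \<in> set_ha_term t \<Longrightarrow> e v = e' v) \<Longrightarrow> ha_eval H e t = ha_eval H e' t"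
  by (induction t) auto

lemma ha_eval_map: "ha_eval H e (map_ha_term f t) = ha_eval H (e \<circ> f) t"
  by (induction t) auto

subsection \<open>Intervals, products and isomorphic copies\<close>

text \<open>This is the quotient of H by the filter generated by u, presented by the representatives
  below u so that the carrier stays in the same type. Implication is cut down by u because
  \<open>x \<Rrightarrow> y\<close> need not lie below u.\<close>

definition interval_algebra :: "'a heyting \<Rightarrow> 'a \<Rightarrow> 'a heyting" where
  "interval_algebra H u =
     \<lparr>carrier = {x \<in> carrier H. x \<curlywedge>\<^bsub>H\<^esub> u = x}, hzero = hzero H, hone = u,
      hjoin = hjoin H, hmeet = hmeet H, himp = (\<lambda>x y. (x \<Rrightarrow>\<^bsub>H\<^esub> y) \<curlywedge>\<^bsub>H\<^esub> u)\<rparr>"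

lemma interval_algebra_heyting:
  assumes "heyting_algebra H" and u: "u \<in> carrier H"
  shows "heyting_algebra (interval_algebra H u)"
proof -
  interpret heyting_algebra H by fact
  have u_meet: "z \<curlywedge>\<^bsub>H\<^esub> (x \<curlywedge>\<^bsub>H\<^esub> u) = z \<longleftrightarrow> z \<curlywedge>\<^bsub>H\<^esub> x = z"
    if "z \<curlywedge>\<^bsub>H\<^esub> u = z" "x \<in> carrier H" "z \<in> carrier H" for x z
    using that u by (simp add: le_meet_iff)
  show ?thesis
    unfolding interval_algebra_def
  proof (unfold_locales, goal_cases)
    case (3 x y) then show ?case using u by (simp add: join_le_iff closed)
  next
    case (4 x y) then show ?case using u by (simp add: meet_assoc closed)
  next
    case (5 x y) then show ?case using u by (simp add: meet_assoc meet_idem closed)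
  qed (use u in \<open>auto simp: closed zero_least meet_idem join_absorb meet_absorb residuation u_meet
      intro: join_assoc join_comm meet_assoc meet_comm\<close>)
qed

text \<open>The map sending x to \<open>x \<curlywedge> u\<close> is a homomorphism onto the
  interval; the distribution identities above are its compatibility with the operations.\<close>

lemma ha_eval_interval_algebra:
  assumes "heyting_algebra H" and u: "u \<in> carrier H" and e: "e ` set_ha_term t \<subseteq> carrier H"
  shows "ha_eval (interval_algebra H u) (\<lambda>v. e v \<curlywedge>\<^bsub>H\<^esub> u) t = ha_eval H e t \<curlywedge>\<^bsub>H\<^esub> u"
proof -
  interpret heyting_algebra H by fact
  have "u \<curlywedge>\<^bsub>H\<^esub> hone H = u" "hone H \<curlywedge>\<^bsub>H\<^esub> u = u"
    using u by (metis meet_comm one_closed one_greatest)+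
  then show ?thesis
    using e
    by (induction t)
      (use u in \<open>auto simp: interval_algebra_def zero_least meet_join_distrib image_Un
        meet_meet_distrib[symmetric] imp_meet_relative[symmetric] eval_closed\<close>)
qed

lemma interval_algebra_satisfies_eq:
  assumes "heyting_algebra H" and u: "u \<in> carrier H" and "ha_satisfies_eq H q"
  shows "ha_satisfies_eq (interval_algebra H u) q"
  unfolding ha_satisfies_eq_def
proof (intro allI impI)
  fix e :: "nat \<Rightarrow> 'a" assume "range e \<subseteq> carrier (interval_algebra H u)"
  then have e: "range e \<subseteq> carrier H" and "(\<lambda>v. e v \<curlywedge>\<^bsub>H\<^esub> u) = e"
    by (auto simp: interval_algebra_def)
  then have "ha_eval (interval_algebra H u) e t = ha_eval H e t \<curlywedge>\<^bsub>H\<^esub> u" for t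
    using ha_eval_interval_algebra[OF assms(1) u, of e t] by auto
  then show "ha_eval (interval_algebra H u) e (fst q) = ha_eval (interval_algebra H u) e (snd q)"
    using assms(3) e by (simp add: ha_satisfies_eq_def)
qed

section \<open>Direct products\<close>

text \<open>Extensional functions make elements with the same coordinates over I equal, and keep the
  product of finitely many finite factors finite.\<close>

definition product_algebra :: "'i set \<Rightarrow> ('i \<Rightarrow> 'a heyting) \<Rightarrow> ('i \<Rightarrow> 'a) heyting" where
  "product_algebra I F =
     \<lparr>carrier = (\<Pi>\<^sub>E i\<in>I. carrier (F i)),
      hzero = (\<lambda>i\<in>I. hzero (F i)), hone = (\<lambda>i\<in>I. hone (F i)),
      hjoin = (\<lambda>x y. \<lambda>i\<in>I. x i \<curlyvee>\<^bsub>F i\<^esub> y i), hmeet = (\<lambda>x y. \<lambda>i\<in>I. x i \<curlywedge>\<^bsub>F i\<^esub> y i),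
      himp = (\<lambda>x y. \<lambda>i\<in>I. x i \<Rrightarrow>\<^bsub>F i\<^esub> y i)\<rparr>"

lemma restrict_eq_PiE_iff:
  "x \<in> (\<Pi>\<^sub>E i\<in>I. S i) \<Longrightarrow> restrict f I = x \<longleftrightarrow> (\<forall>i\<in>I. f i = x i)"
  by (auto simp: fun_eq_iff PiE_def extensional_def)

lemma product_algebra_heyting:
  assumes F: "\<And>i. i \<in> I \<Longrightarrow> heyting_algebra (F i)"
  shows "heyting_algebra (product_algebra I F)"
  unfolding product_algebra_def
proof (unfold_locales, goal_cases)
  \<comment> \<open>Goal 14 is residuation, the one law that is an equivalence between equations; it
    is read off coordinate by coordinate.\<close>
  case (14 x y z)
  then show ?case
    using heyting_algebra.residuation[OF F]
    by (auto simp: restrict_eq_PiE_iff PiE_iff restrict_def fun_eq_iff extensional_def)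
qed (auto simp: restrict_eq_PiE_iff PiE_iff restrict_def fun_eq_iff
      heyting_algebra.zero_closed[OF F] heyting_algebra.one_closed[OF F]
      heyting_algebra.join_closed[OF F] heyting_algebra.meet_closed[OF F]
      heyting_algebra.imp_closed[OF F] heyting_algebra.join_assoc[OF F]
      heyting_algebra.join_absorb[OF F] heyting_algebra.meet_assoc[OF F]
      heyting_algebra.meet_absorb[OF F] heyting_algebra.zero_least[OF F]
      heyting_algebra.one_greatest[OF F] extensional_def
      intro: heyting_algebra.join_comm[OF F] heyting_algebra.meet_comm[OF F])

lemma ha_eval_product_algebra:
  "i \<in> I \<Longrightarrow> ha_eval (product_algebra I F) e t i = ha_eval (F i) (\<lambda>v. e v i) t"
  by (induction t) (auto simp: product_algebra_def)

lemma product_algebra_satisfies_eq: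
  assumes F: "\<And>i. i \<in> I \<Longrightarrow> heyting_algebra (F i)"
    and sat: "\<And>i. i \<in> I \<Longrightarrow> ha_satisfies_eq (F i) q"
  shows "ha_satisfies_eq (product_algebra I F) q"
  unfolding ha_satisfies_eq_def
proof (intro allI impI)
  fix e :: "nat \<Rightarrow> 'a \<Rightarrow> 'b" assume e: "range e \<subseteq> carrier (product_algebra I F)"
  interpret heyting_algebra "product_algebra I F"
    by (rule product_algebra_heyting[OF F])
  have cl: "ha_eval (product_algebra I F) e t \<in> (\<Pi>\<^sub>E i\<in>I. carrier (F i))" for t
    using eval_closed[of e t] e by (auto simp: product_algebra_def)
  show "ha_eval (product_algebra I F) e (fst q) = ha_eval (product_algebra I F) e (snd q)"
  proof (rule PiE_ext[OF cl cl])
    fix i assume i: "i \<in> I"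
    then have "range (\<lambda>v. e v i) \<subseteq> carrier (F i)"
      using e by (fastforce simp: product_algebra_def)
    then show "ha_eval (product_algebra I F) e (fst q) i = ha_eval (product_algebra I F) e (snd q) i"
      using sat[OF i] i by (simp add: ha_eval_product_algebra ha_satisfies_eq_def)
  qed
qed

section \<open>Isomorphic copies\<close>

text \<open>Transport of structure along a map f injective on the carrier. It brings the product,
  which lives in a function type, back into the type of the members of the variety.\<close>

definition image_algebra :: "('a \<Rightarrow> 'b) \<Rightarrow> 'a heyting \<Rightarrow> 'b heyting" where
  "image_algebra f H = (let g = inv_into (carrier H) f in
     \<lparr>carrier = f ` carrier H, hzero = f (hzero H), hone = f (hone H),
      hjoin = (\<lambda>x y. f (g x \<curlyvee>\<^bsub>H\<^esub> g y)), hmeet = (\<lambda>x y. f (g x \<curlywedge>\<^bsub>H\<^esub> g y)),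
      himp = (\<lambda>x y. f (g x \<Rrightarrow>\<^bsub>H\<^esub> g y))\<rparr>)"

lemma image_algebra_heyting:
  assumes "heyting_algebra H" and f: "inj_on f (carrier H)"
  shows "heyting_algebra (image_algebra f H)"
proof -
  interpret heyting_algebra H by fact
  note [simp] = inv_into_f_f[OF f] inj_on_eq_iff[OF f] closed
  show ?thesis
    unfolding image_algebra_def Let_def
    by unfold_locales
      (auto simp: join_assoc join_absorb meet_assoc meet_absorb zero_least one_greatest residuation
        intro: join_comm meet_comm)
qed

lemma ha_eval_image_algebra:
  assumes "heyting_algebra H" and f: "inj_on f (carrier H)" and e: "e ` set_ha_term t \<subseteq> carrier H"
  shows "ha_eval (image_algebra f H) (f \<circ> e) t = f (ha_eval H e t)"
  using e
proof (induction t)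
qed (auto simp: image_algebra_def Let_def inv_into_f_f[OF f] image_Un
    heyting_algebra.eval_closed[OF assms(1)])

lemma image_algebra_satisfies_eq:
  assumes "heyting_algebra H" and f: "inj_on f (carrier H)" and "ha_satisfies_eq H q"
  shows "ha_satisfies_eq (image_algebra f H) q"
  unfolding ha_satisfies_eq_def
proof (intro allI impI)
  fix e :: "nat \<Rightarrow> 'b" assume "range e \<subseteq> carrier (image_algebra f H)"
  then have "\<forall>v. \<exists>x\<in>carrier H. e v = f x"
    by (auto simp: image_algebra_def Let_def)
  then obtain d where d: "range d \<subseteq> carrier H" and e: "e = f \<circ> d"
    by (metis (no_types, lifting) comp_apply ext image_subsetI)
  then have "ha_eval (image_algebra f H) e t = f (ha_eval H d t)" for t
    using ha_eval_image_algebra[OF assms(1) f, of d t] by auto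
  then show "ha_eval (image_algebra f H) e (fst q) = ha_eval (image_algebra f H) e (snd q)"
    using assms(3) d by (simp add: ha_satisfies_eq_def)
qed

subsection \<open>Realising finitely many equations and inequations\<close>

fun biimp_meet :: "('v ha_term \<times> 'v ha_term) list \<Rightarrow> 'v ha_term" where
  "biimp_meet [] = TOne"
| "biimp_meet ((p, q) # qs) = TMeet (TMeet (TImp p q) (TImp q p)) (biimp_meet qs)"

lemma biimp_meet_eq_one:
  assumes "heyting_algebra H" and e: "range e \<subseteq> carrier H"
    and "\<And>p q. (p, q) \<in> set qs \<Longrightarrow> ha_eval H e p = ha_eval H e q"
  shows "ha_eval H e (biimp_meet qs) = hone H"
  using assms(3)
proof (induction qs rule: biimp_meet.induct)
  case (2 p q qs)
  interpret heyting_algebra H by fact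
  have "ha_eval H e q \<in> carrier H" using e by (intro eval_closed) auto
  then have "ha_eval H e q \<Rrightarrow>\<^bsub>H\<^esub> ha_eval H e q = hone H"
    by (simp add: imp_eq_one_iff meet_idem)
  moreover have "ha_eval H e p = ha_eval H e q" "ha_eval H e (biimp_meet qs) = hone H"
    using 2 by auto
  ultimately show ?case by (simp add: meet_idem closed)
qed simp

text \<open>The value of \<open>biimp_meet qs\<close> lies below the biimplication of every pair in
  the list, so each pair becomes equal after meeting with it.\<close>

lemma meet_biimp_meet_eq:
  assumes "heyting_algebra H" and e: "range e \<subseteq> carrier H" and "(p, q) \<in> set qs"
  shows "ha_eval H e p \<curlywedge>\<^bsub>H\<^esub> ha_eval H e (biimp_meet qs)
       = ha_eval H e q \<curlywedge>\<^bsub>H\<^esub> ha_eval H e (biimp_meet qs)"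
proof -
  interpret heyting_algebra H by fact
  have cl [simp]: "ha_eval H e t \<in> carrier H" for t using e by (intro eval_closed) auto
  have "ha_eval H e (biimp_meet qs) \<curlywedge>\<^bsub>H\<^esub> ha_eval H e (TMeet (TImp p q) (TImp q p))
      = ha_eval H e (biimp_meet qs)"
    using assms(3)
  proof (induction qs rule: biimp_meet.induct)
    case (2 p' q' qs)
    let ?b = "ha_eval H e (TMeet (TImp p' q') (TImp q' p'))" and ?r = "ha_eval H e (biimp_meet qs)"
    have le: "?b \<curlywedge>\<^bsub>H\<^esub> ?r \<sqsubseteq> ?b" "?b \<curlywedge>\<^bsub>H\<^esub> ?r \<sqsubseteq> ?r"
      using cl by (meson le_meet_iff le_refl meet_closed)+
    show ?case
    proof (cases "(p, q) = (p', q')")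
      case True
      then show ?thesis using le(1) by simp
    next
      case False
      with 2 have "?r \<sqsubseteq> ha_eval H e (TMeet (TImp p q) (TImp q p))" by auto
      then have "?b \<curlywedge>\<^bsub>H\<^esub> ?r \<sqsubseteq> ha_eval H e (TMeet (TImp p q) (TImp q p))"
        using le(2) cl by (meson le_trans meet_closed)
      then show ?thesis by simp
    qed
  qed simp
  then show ?thesis by (intro le_biimp_imp_meet_eq) simp_all
qed

section \<open>Finite realisation of equations and inequations\<close>

text \<open>The finite model property speaks of single equations only. Meeting both sides with
  \<open>biimp_meet qs\<close> packs the premises D into one equation, and passing to an interval
  unpacks them again in the finite algebra.\<close>

lemma finite_refutation:
  fixes E D :: "ha_equation set"
  defines "V \<equiv> {H :: 'a heyting. heyting_algebra H \<and> (\<forall>q\<in>E. ha_satisfies_eq H q)}"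
  assumes fmp: "finite_model_property V" and B: "B \<in> V" and e: "range e \<subseteq> carrier B"
    and D: "finite D" "\<And>p q. (p, q) \<in> D \<Longrightarrow> ha_eval B e p = ha_eval B e q"
    and ne: "ha_eval B e s \<noteq> ha_eval B e t"
  shows "\<exists>C\<in>V. finite (carrier C) \<and> (\<exists>d. range d \<subseteq> carrier C \<and>
    (\<forall>(p, q)\<in>D. ha_eval C d p = ha_eval C d q) \<and> ha_eval C d s \<noteq> ha_eval C d t)"
proof -
  obtain qs where qs: "set qs = D" using D(1) finite_list by blast
  interpret B: heyting_algebra B using B by (simp add: V_def)
  have "ha_eval B e (biimp_meet qs) = hone B"
    using biimp_meet_eq_one[OF B.heyting_algebra_axioms e] D(2) qs by blast
  moreover have "ha_eval B e r \<in> carrier B" for r using e by (intro B.eval_closed) auto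
  \<comment> \<open>Under e the added factor has value one, so the two sides keep the distinct
    values of s and t.\<close>
  ultimately have "\<not> ha_satisfies_eq B (TMeet s (biimp_meet qs), TMeet t (biimp_meet qs))"
    using e ne by (auto simp: ha_satisfies_eq_def B.one_greatest intro!: exI[of _ e])
  then obtain H where H: "H \<in> V" "finite (carrier H)"
    and "\<not> ha_satisfies_eq H (TMeet s (biimp_meet qs), TMeet t (biimp_meet qs))"
    using fmp B unfolding finite_model_property_def by blast
  then obtain d where d: "range d \<subseteq> carrier H"
    and dne: "ha_eval H d s \<curlywedge>\<^bsub>H\<^esub> ha_eval H d (biimp_meet qs)
      \<noteq> ha_eval H d t \<curlywedge>\<^bsub>H\<^esub> ha_eval H d (biimp_meet qs)"
    by (auto simp: ha_satisfies_eq_def)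
  interpret heyting_algebra H using H by (simp add: V_def)
  \<comment> \<open>Cutting down to u makes every equation in D true, while s and t stay apart
    because their values already differ after meeting with u.\<close>
  define u where "u = ha_eval H d (biimp_meet qs)"
  have u: "u \<in> carrier H" unfolding u_def using d by (intro eval_closed) auto
  let ?C = "interval_algebra H u" and ?d = "\<lambda>v. d v \<curlywedge>\<^bsub>H\<^esub> u"
  have ev: "ha_eval ?C ?d r = ha_eval H d r \<curlywedge>\<^bsub>H\<^esub> u" for r
    using d by (intro ha_eval_interval_algebra[OF heyting_algebra_axioms u]) auto
  have "?C \<in> V"
    using H(1) u by (simp add: V_def interval_algebra_heyting interval_algebra_satisfies_eq)
  moreover have "finite (carrier ?C)"
    using H(2) by (simp add: interval_algebra_def)
  moreover have "range ?d \<subseteq> carrier ?C"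
    using d u by (auto simp: interval_algebra_def meet_closed meet_assoc meet_idem image_subset_iff)
  moreover have "\<forall>(p, q)\<in>D. ha_eval ?C ?d p = ha_eval ?C ?d q"
    using meet_biimp_meet_eq[OF heyting_algebra_axioms d, of _ _ qs]
    by (auto simp: ev qs u_def[symmetric])
  moreover have "ha_eval ?C ?d s \<noteq> ha_eval ?C ?d t"
    using dne by (simp add: ev u_def[symmetric])
  ultimately show ?thesis by blast
qed

text \<open>Each false equation contributes one factor of a product: the true equations hold in
  every coordinate, and each false one fails in its own. The product has another type than the
  members of V, so its equations are stated explicitly instead of membership in V.\<close>

lemma finite_realization_nat:
  fixes E S :: "ha_equation set"
  defines "V \<equiv> {H :: 'a heyting. heyting_algebra H \<and> (\<forall>q\<in>E. ha_satisfies_eq H q)}"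
  assumes fmp: "finite_model_property V" and B: "B \<in> V" and e: "range e \<subseteq> carrier B"
    and S: "finite S"
  obtains C :: "(ha_equation \<Rightarrow> 'a) heyting" and d
  where "heyting_algebra C" "\<And>q. q \<in> E \<Longrightarrow> ha_satisfies_eq C q" "finite (carrier C)"
    "range d \<subseteq> carrier C"
    "\<And>p q. (p, q) \<in> S \<Longrightarrow> ha_eval C d p = ha_eval C d q \<longleftrightarrow> ha_eval B e p = ha_eval B e q"
proof -
  define D where "D = {(p, q) \<in> S. ha_eval B e p = ha_eval B e q}"
  define N where "N = S - D"
  \<comment> \<open>Algebra and assignment are paired so that both are chosen at once for each
    index.\<close>
  define P where "P i G \<longleftrightarrow> fst G \<in> V \<and> finite (carrier (fst G)) \<and>
      range (snd G) \<subseteq> carrier (fst G) \<and>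
      (\<forall>(p, q)\<in>D. ha_eval (fst G) (snd G) p = ha_eval (fst G) (snd G) q) \<and>
      ha_eval (fst G) (snd G) (fst i) \<noteq> ha_eval (fst G) (snd G) (snd i)" for i :: ha_equation and G
  have "\<exists>G. P i G"
    if "i \<in> N" for i
  proof -
    have "finite D" using S by (rule rev_finite_subset) (auto simp: D_def)
    moreover have "ha_eval B e p = ha_eval B e q" if "(p, q) \<in> D" for p q
      using that by (simp add: D_def)
    moreover have "ha_eval B e (fst i) \<noteq> ha_eval B e (snd i)"
      using that by (auto simp: D_def N_def)
    ultimately show ?thesis
      using finite_refutation[OF fmp[unfolded V_def] B[unfolded V_def] e, of D "fst i" "snd i"]
      unfolding V_def[symmetric] P_def by (metis fst_conv snd_conv)
  qed
  then obtain G where G: "\<And>i. i \<in> N \<Longrightarrow> P i (G i)" by metis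
  define F d where "F i = fst (G i)" and "d i = snd (G i)" for i
  have F: "F i \<in> V" "finite (carrier (F i))"
    and d: "range (d i) \<subseteq> carrier (F i)"
    and eqs: "\<And>p q. (p, q) \<in> D \<Longrightarrow> ha_eval (F i) (d i) p = ha_eval (F i) (d i) q"
    and neqs: "ha_eval (F i) (d i) (fst i) \<noteq> ha_eval (F i) (d i) (snd i)" if "i \<in> N" for i
    using G[OF that] by (auto simp: P_def F_def d_def)
  \<comment> \<open>If no equation of S is false, N is empty and this is the one-element algebra, in
    which all of S holds.\<close>
  let ?C = "product_algebra N F"
  define d' where "d' v = (\<lambda>i\<in>N. d i v)" for v
  have hF: "heyting_algebra (F i)" if "i \<in> N" for i using F(1)[OF that] by (simp add: V_def)
  have C: "heyting_algebra ?C" by (rule product_algebra_heyting[OF hF])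
  have d'C: "range d' \<subseteq> carrier ?C"
    using d by (fastforce simp: d'_def product_algebra_def)
  have ev: "ha_eval ?C d' t i = ha_eval (F i) (d i) t" if "i \<in> N" for t i
    using that by (simp add: ha_eval_product_algebra d'_def)
  show thesis
  proof (rule that[of ?C d'])
    show "ha_satisfies_eq ?C q" if "q \<in> E" for q
      using that F(1) by (intro product_algebra_satisfies_eq hF) (auto simp: V_def)
    show "finite (carrier ?C)"
      using S F(2) by (auto simp: product_algebra_def N_def intro!: finite_PiE)
    show "ha_eval ?C d' p = ha_eval ?C d' q \<longleftrightarrow> ha_eval B e p = ha_eval B e q"
      if pq: "(p, q) \<in> S" for p q
    proof (cases "(p, q) \<in> D")
      case True
      have cl: "ha_eval ?C d' t \<in> (\<Pi>\<^sub>E i\<in>N. carrier (F i))" for t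
        using heyting_algebra.eval_closed[OF C, of d' t] d'C by (auto simp: product_algebra_def)
      have "ha_eval ?C d' p = ha_eval ?C d' q"
        by (rule PiE_ext[OF cl cl]) (simp add: ev eqs[OF _ True])
      then show ?thesis using True by (simp add: D_def)
    next
      case False
      then have N: "(p, q) \<in> N" using pq by (simp add: N_def)
      then have "ha_eval ?C d' p (p, q) \<noteq> ha_eval ?C d' q (p, q)"
        using neqs[OF N] by (simp add: ev)
      then have "ha_eval ?C d' p \<noteq> ha_eval ?C d' q" by metis
      then show ?thesis using False pq by (simp add: D_def)
    qed
  qed (fact C d'C)+
qed

text \<open>Equations of a variety use variables in \<open>nat\<close>, so the variables in W are
  renamed along \<iota> and the resulting assignment is pulled back.\<close>

lemma finite_realization:
  fixes E :: "ha_equation set" and S :: "('v ha_term \<times> 'v ha_term) set"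
  defines "V \<equiv> {H :: 'a heyting. heyting_algebra H \<and> (\<forall>q\<in>E. ha_satisfies_eq H q)}"
  assumes fmp: "finite_model_property V" and B: "B \<in> V" and e: "e ` W \<subseteq> carrier B"
    and S: "finite S" and W: "\<And>p q. (p, q) \<in> S \<Longrightarrow> set_ha_term p \<union> set_ha_term q \<subseteq> W"
    and \<iota>: "inj_on (\<iota> :: 'v \<Rightarrow> nat) W"
  obtains C :: "(ha_equation \<Rightarrow> 'a) heyting" and d
  where "heyting_algebra C" "\<And>q. q \<in> E \<Longrightarrow> ha_satisfies_eq C q" "finite (carrier C)"
    "range d \<subseteq> carrier C"
    "\<And>p q. (p, q) \<in> S \<Longrightarrow> ha_eval C d p = ha_eval C d q \<longleftrightarrow> ha_eval B e p = ha_eval B e q"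
proof -
  \<comment> \<open>Numbers that code no variable in W receive the default \<open>hzero B\<close>,
    so that all values lie in the carrier.\<close>
  define e' where "e' n = (if n \<in> \<iota> ` W then e (inv_into W \<iota> n) else hzero B)" for n
  have "heyting_algebra B" using B by (simp add: V_def)
  then have "range e' \<subseteq> carrier B"
    using e by (auto simp: e'_def heyting_algebra.zero_closed inv_into_f_f[OF \<iota>])
  then obtain C :: "(ha_equation \<Rightarrow> 'a) heyting" and d
    where C: "heyting_algebra C" "\<And>q. q \<in> E \<Longrightarrow> ha_satisfies_eq C q" "finite (carrier C)"
      and d: "range d \<subseteq> carrier C"
      and iff: "\<And>p q. (p, q) \<in> map_prod (map_ha_term \<iota>) (map_ha_term \<iota>) ` S \<Longrightarrow>
        ha_eval C d p = ha_eval C d q \<longleftrightarrow> ha_eval B e' p = ha_eval B e' q"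
    using finite_realization_nat[OF fmp[unfolded V_def] B[unfolded V_def], of e'
        "map_prod (map_ha_term \<iota>) (map_ha_term \<iota>) ` S"] S by blast
  show thesis
  proof (rule that[of C "d \<circ> \<iota>"])
    fix p q assume pq: "(p, q) \<in> S"
    have "ha_eval B e' (map_ha_term \<iota> t) = ha_eval B e t" if "set_ha_term t \<subseteq> W" for t
      unfolding ha_eval_map using that
      by (intro ha_eval_cong) (auto simp: e'_def inv_into_f_f[OF \<iota>] subset_iff simp del: image_iff)
    moreover have "(map_ha_term \<iota> p, map_ha_term \<iota> q) \<in> map_prod (map_ha_term \<iota>) (map_ha_term \<iota>) ` S"
      using pq by (auto intro: rev_image_eqI)
    ultimately show "ha_eval C (d \<circ> \<iota>) p = ha_eval C (d \<circ> \<iota>) q \<longleftrightarrow> ha_eval B e p = ha_eval B e q"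
      using iff W[OF pq] by (simp add: ha_eval_map[symmetric])
  qed (use C d in auto)
qed

subsection \<open>Formulas and diagrams\<close>

primrec atoms :: "'a ha_formula \<Rightarrow> ((nat + 'a) ha_term \<times> (nat + 'a) ha_term) set" where
  "atoms FFalse = {}"
| "atoms (FEq s t) = {(s, t)}"
| "atoms (FNot \<phi>) = atoms \<phi>"
| "atoms (FAnd \<phi> \<psi>) = atoms \<phi> \<union> atoms \<psi>"
| "atoms (FOr \<phi> \<psi>) = atoms \<phi> \<union> atoms \<psi>"
| "atoms (FImp \<phi> \<psi>) = atoms \<phi> \<union> atoms \<psi>"
| "atoms (FEx n \<phi>) = atoms \<phi>"
| "atoms (FAll n \<phi>) = atoms \<phi>"

lemma finite_atoms: "finite (atoms \<phi>)"
  by (induction \<phi>) auto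

lemma atoms_vars:
  "(s, t) \<in> atoms \<phi> \<Longrightarrow> set_ha_term s \<union> set_ha_term t \<subseteq> range Inl \<union> Inr ` parameters \<phi>"
proof (induction \<phi>)
  case (FEq p q)
  have "x \<in> range Inl \<union> Inr ` parameters (FEq p q)" if "x \<in> set_ha_term p \<union> set_ha_term q" for x
    using that by (cases x) (force simp: image_iff intro: setr.intros)+
  with FEq show ?case by auto
qed auto

lemma quantifier_free_sat_cong:
  assumes "quantifier_free \<phi>"
    and "\<And>s t. (s, t) \<in> atoms \<phi> \<Longrightarrow>
      ha_eval H (case_sum e id) s = ha_eval H (case_sum e id) t \<longleftrightarrow>
      ha_eval K (case_sum d id) s = ha_eval K (case_sum d id) t"
  shows "ha_sat H e \<phi> \<longleftrightarrow> ha_sat K d \<phi>"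
  using assms by (induction \<phi>) auto

text \<open>Free variables are already read existentially in \<open>ha_satisfied_in\<close>, so a
  leading existential quantifier adds nothing.\<close>

lemma satisfied_in_FEx: "ha_satisfied_in H (FEx n \<phi>) \<longleftrightarrow> ha_satisfied_in H \<phi>"
proof
  assume "ha_satisfied_in H (FEx n \<phi>)"
  then obtain e x where "range e \<subseteq> carrier H" "x \<in> carrier H" "ha_sat H (e(n := x)) \<phi>"
    by (auto simp: ha_satisfied_in_def)
  moreover from this have "range (e(n := x)) \<subseteq> carrier H" by auto
  ultimately show "ha_satisfied_in H \<phi>" unfolding ha_satisfied_in_def by blast
next
  assume "ha_satisfied_in H \<phi>"
  \<comment> \<open>Writing e as \<open>e(n := e n)\<close> exhibits \<open>e n\<close> as the
    witness.\<close>
  then obtain e where "range e \<subseteq> carrier H" "ha_sat H (e(n := e n)) \<phi>"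
    by (auto simp: ha_satisfied_in_def)
  then show "ha_satisfied_in H (FEx n \<phi>)"
    unfolding ha_satisfied_in_def ha_sat.simps by blast
qed

lemma existential_matrix:
  assumes "existential_formula \<phi>"
  obtains \<theta> where "quantifier_free \<theta>" "parameters \<theta> = parameters \<phi>"
    "\<And>H. ha_satisfied_in H \<theta> \<longleftrightarrow> ha_satisfied_in H \<phi>"
  using assms
proof (induction arbitrary: thesis)
  case (1 \<phi>)
  then show ?case by blast
next
  case (2 \<phi> n)
  obtain \<theta> where "quantifier_free \<theta>" "parameters \<theta> = parameters \<phi>"
    "\<And>H. ha_satisfied_in H \<theta> \<longleftrightarrow> ha_satisfied_in H \<phi>"
    using "2.IH" by blast
  then show ?case
    by (intro "2.prems"[of \<theta>]) (simp_all add: satisfied_in_FEx)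
qed

section \<open>Diagrams and embeddings\<close>

text \<open>Each element x of A is named by the variable \<open>Inr x\<close>. The pairs
  \<open>(c x, c y)\<close> for distinct x and y are false equations; realising them as false is
  what makes the map from A injective.\<close>

definition diagram :: "'a heyting \<Rightarrow> (('v + 'a) ha_term \<times> ('v + 'a) ha_term) set" where
  "diagram A = (let c = TVar \<circ> Inr in
     {(TZero, c (hzero A)), (TOne, c (hone A))} \<union>
     (\<Union>x\<in>carrier A. \<Union>y\<in>carrier A.
       {(c x, c y), (TJoin (c x) (c y), c (x \<curlyvee>\<^bsub>A\<^esub> y)),
        (TMeet (c x) (c y), c (x \<curlywedge>\<^bsub>A\<^esub> y)), (TImp (c x) (c y), c (x \<Rrightarrow>\<^bsub>A\<^esub> y))}))"

lemma finite_diagram: "finite (carrier A) \<Longrightarrow> finite (diagram A)"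
  by (simp add: diagram_def Let_def)

lemma diagram_vars:
  assumes "heyting_algebra A" and "(s, t) \<in> diagram A"
  shows "set_ha_term s \<union> set_ha_term t \<subseteq> Inr ` carrier A"
proof -
  interpret heyting_algebra A by fact
  show ?thesis using assms(2) by (auto simp: diagram_def Let_def closed)
qed

text \<open>This serves to make an algebra contain A itself and not merely a copy of it: f undoes h
  on its image and sends the rest of Y to fresh elements outside X, of which an infinite type has
  enough.\<close>

lemma finite_injection_extending_inverse:
  assumes "finite Y" and "inj_on h X" and "h ` X \<subseteq> Y" and "infinite (UNIV :: 'a set)"
  obtains f :: "'b \<Rightarrow> 'a" where "inj_on f Y" "\<And>x. x \<in> X \<Longrightarrow> f (h x) = x"
proof -
  have "finite X" using assms by (metis finite_imageD finite_subset)
  then have "infinite (UNIV - X)" using assms(4) by simp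
  then obtain Z where Z: "Z \<subseteq> UNIV - X" "finite Z" "card Z = card (Y - h ` X)"
    using infinite_arbitrarily_large by blast
  then obtain g where g: "bij_betw g (Y - h ` X) Z"
    using assms(1) by (metis finite_Diff finite_same_card_bij)
  define f where "f y = (if y \<in> h ` X then inv_into X h y else g y)" for y
  have fh: "f (h x) = x" if "x \<in> X" for x
    using that assms(2) by (simp add: f_def)
  have "inj_on f (h ` X)"
    using fh by (auto simp: inj_on_def)
  moreover have fg: "f y = g y" if "y \<in> Y - h ` X" for y
    using that by (simp add: f_def)
  then have "inj_on f (Y - h ` X)"
    using g by (metis bij_betw_imp_inj_on inj_on_cong)
  moreover have "f ` (h ` X) \<inter> f ` (Y - h ` X) = {}"
  proof -
    have "f ` (h ` X) \<subseteq> X" using fh by auto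
    moreover have "f ` (Y - h ` X) \<subseteq> Z" using fg g by (auto simp: bij_betw_def)
    ultimately show ?thesis using Z(1) by blast
  qed
  ultimately have "inj_on f (h ` X \<union> (Y - h ` X))"
    unfolding inj_on_Un by blast
  moreover have "h ` X \<union> (Y - h ` X) = Y" using assms(3) by blast
  ultimately have "inj_on f Y" by simp
  then show thesis using fh that by blast
qed

section \<open>Construction of the finite extension\<close>

theorem theorem7p6:
  fixes V :: "'a heyting set" and A :: "'a heyting" and \<phi> :: "'a ha_formula"
  assumes "heyting_variety V" and "finite_model_property V"
    and "A \<in> V" and "finite (carrier A)"
    and "existential_formula \<phi>" and "parameters \<phi> \<subseteq> carrier A"
    and "\<exists>B\<in>V. heyting_subalgebra A B \<and> ha_satisfied_in B \<phi>"
  shows "\<exists>C\<in>V. finite (carrier C) \<and> heyting_subalgebra A C \<and> ha_satisfied_in C \<phi>"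
proof (cases "finite (UNIV :: 'a set)")
  \<comment> \<open>Over a finite type the given extension is itself finite. Otherwise the type
    supplies fresh elements for the final copy.\<close>
  case True
  then show ?thesis using assms(7) by (meson finite_subset subset_UNIV)
next
  case inf: False
  obtain E where V: "V = {H. heyting_algebra H \<and> (\<forall>q\<in>E. ha_satisfies_eq H q)}"
    using assms(1) by (auto simp: heyting_variety_def)
  obtain \<theta> where \<theta>: "quantifier_free \<theta>" "parameters \<theta> = parameters \<phi>"
    and \<theta>\<phi>: "\<And>H. ha_satisfied_in H \<theta> \<longleftrightarrow> ha_satisfied_in H \<phi>"
    using existential_matrix[OF assms(5)] by metis
  obtain B where B: "B \<in> V" "heyting_subalgebra A B" "ha_satisfied_in B \<theta>"
    using assms(7) \<theta>\<phi> by blast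
  obtain e where e: "range e \<subseteq> carrier B" "ha_sat B e \<theta>"
    using B(3) by (auto simp: ha_satisfied_in_def)
  interpret A: heyting_algebra A using assms(3) by (simp add: V)
  define W :: "(nat + 'a) set" where "W = range Inl \<union> Inr ` carrier A"
  define S where "S = atoms \<theta> \<union> diagram A"
  obtain \<gamma> :: "'a \<Rightarrow> nat" where \<gamma>: "inj_on \<gamma> (carrier A)"
    using finite_imp_inj_to_nat_seg[OF assms(4)] by blast
  \<comment> \<open>Even numbers code the formula variables and odd numbers the elements of
    A.\<close>
  define \<iota> where "\<iota> = case_sum (\<lambda>n. 2 * n) (\<lambda>a. 2 * \<gamma> a + 1)"
  have \<iota>: "inj_on \<iota> W"
  proof (rule inj_onI)
    fix x y assume "x \<in> W" "y \<in> W" "\<iota> x = \<iota> y"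
    moreover have "2 * m \<noteq> 2 * n + 1" for m n :: nat by presburger
    ultimately show "x = y"
      by (cases x; cases y) (auto simp: \<iota>_def W_def inj_on_eq_iff[OF \<gamma>] simp del: One_nat_def, metis+)
  qed
  have vars: "set_ha_term p \<union> set_ha_term q \<subseteq> W" if "(p, q) \<in> S" for p q
    using that atoms_vars[of p q \<theta>] diagram_vars[OF A.heyting_algebra_axioms, of p q] \<theta>(2) assms(6)
    unfolding S_def W_def by blast
  have eW: "case_sum e id ` W \<subseteq> carrier B"
    using e(1) B(2) by (auto simp: W_def heyting_subalgebra_def)
  have "finite S" using assms(4) by (simp add: S_def finite_atoms finite_diagram)
  then obtain C :: "(ha_equation \<Rightarrow> 'a) heyting" and d
    where C: "heyting_algebra C" "\<And>q. q \<in> E \<Longrightarrow> ha_satisfies_eq C q" "finite (carrier C)"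
      and d: "range d \<subseteq> carrier C"
      and iff: "\<And>p q. (p, q) \<in> S \<Longrightarrow> ha_eval C d p = ha_eval C d q \<longleftrightarrow>
        ha_eval B (case_sum e id) p = ha_eval B (case_sum e id) q"
    using finite_realization[OF assms(2)[unfolded V] B(1)[unfolded V] eW _ vars \<iota>] by blast
  \<comment> \<open>The interpretation in C of the names of elements; the diagram makes it an
    embedding of A.\<close>
  define h where "h = d \<circ> Inr"
  have diag: "ha_eval C d p = ha_eval C d q \<longleftrightarrow>
      ha_eval B (case_sum e id) p = ha_eval B (case_sum e id) q" if "(p, q) \<in> diagram A" for p q
    using iff that by (simp add: S_def)
  have sub: "hzero A = hzero B" "hone A = hone B" "carrier A \<subseteq> carrier B"
    "\<And>x y. x \<in> carrier A \<Longrightarrow> y \<in> carrier A \<Longrightarrow> x \<curlyvee>\<^bsub>A\<^esub> y = x \<curlyvee>\<^bsub>B\<^esub> y"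
    "\<And>x y. x \<in> carrier A \<Longrightarrow> y \<in> carrier A \<Longrightarrow> x \<curlywedge>\<^bsub>A\<^esub> y = x \<curlywedge>\<^bsub>B\<^esub> y"
    "\<And>x y. x \<in> carrier A \<Longrightarrow> y \<in> carrier A \<Longrightarrow> x \<Rrightarrow>\<^bsub>A\<^esub> y = x \<Rrightarrow>\<^bsub>B\<^esub> y"
    using B(2) by (auto simp: heyting_subalgebra_def)
  have h_inj: "inj_on h (carrier A)"
  proof (rule inj_onI)
    fix x y assume "x \<in> carrier A" "y \<in> carrier A" "h x = h y"
    then show "x = y"
      using diag[of "TVar (Inr x)" "TVar (Inr y)"] by (simp add: diagram_def Let_def h_def)
  qed
  have h0: "hzero C = h (hzero A)" "hone C = h (hone A)"
    using diag[of TZero "TVar (Inr (hzero A))"] diag[of TOne "TVar (Inr (hone A))"]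
    by (simp_all add: diagram_def Let_def h_def sub)
  have hop: "h x \<curlyvee>\<^bsub>C\<^esub> h y = h (x \<curlyvee>\<^bsub>A\<^esub> y)" "h x \<curlywedge>\<^bsub>C\<^esub> h y = h (x \<curlywedge>\<^bsub>A\<^esub> y)"
      "h x \<Rrightarrow>\<^bsub>C\<^esub> h y = h (x \<Rrightarrow>\<^bsub>A\<^esub> y)" if "x \<in> carrier A" "y \<in> carrier A" for x y
    using that diag[of "TJoin (TVar (Inr x)) (TVar (Inr y))" "TVar (Inr (x \<curlyvee>\<^bsub>A\<^esub> y))"]
      diag[of "TMeet (TVar (Inr x)) (TVar (Inr y))" "TVar (Inr (x \<curlywedge>\<^bsub>A\<^esub> y))"]
      diag[of "TImp (TVar (Inr x)) (TVar (Inr y))" "TVar (Inr (x \<Rrightarrow>\<^bsub>A\<^esub> y))"]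
    by (auto simp: diagram_def Let_def h_def sub)
  have hC: "h ` carrier A \<subseteq> carrier C" using d by (auto simp: h_def)
  obtain f :: "(ha_equation \<Rightarrow> 'a) \<Rightarrow> 'a" where f: "inj_on f (carrier C)"
    and fh: "\<And>x. x \<in> carrier A \<Longrightarrow> f (h x) = x"
    using finite_injection_extending_inverse[OF C(3) h_inj hC inf] by metis
  let ?C = "image_algebra f C" and ?e = "\<lambda>n. f (d (Inl n))"
  have "?C \<in> V"
    using C f by (simp add: V image_algebra_heyting image_algebra_satisfies_eq)
  moreover have "finite (carrier ?C)"
    using C(3) by (simp add: image_algebra_def Let_def)
  moreover have "heyting_subalgebra A ?C"
  proof -
    \<comment> \<open>On A the operations of the copy are thus computed through h, and since h
      respects the operations and \<open>f (h x) = x\<close>, they agree with those of A.\<close>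
    have "inv_into (carrier C) f x = h x" if "x \<in> carrier A" for x
      using that hC f fh by (metis image_subset_iff inv_into_f_f)
    moreover have "carrier A \<subseteq> carrier ?C"
      using fh hC by (force simp: image_algebra_def Let_def image_iff)
    ultimately show ?thesis
      using A.heyting_algebra_axioms image_algebra_heyting[OF C(1) f]
      by (simp add: heyting_subalgebra_def image_algebra_def Let_def h0 hop fh A.closed)
  qed
  moreover have "ha_satisfied_in ?C \<theta>"
  proof -
    have ev: "ha_eval ?C (case_sum ?e id) t = f (ha_eval C d t)" if "set_ha_term t \<subseteq> W" for t
    proof -
      \<comment> \<open>On names of elements of A the assignments agree because
        \<open>f (d (Inr a)) = a\<close>: parameters denote themselves in the copy.\<close>
      have "ha_eval ?C (case_sum ?e id) t = ha_eval ?C (f \<circ> d) t"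
        using that fh by (intro ha_eval_cong) (auto simp: W_def h_def)
      also have "\<dots> = f (ha_eval C d t)"
        using d by (intro ha_eval_image_algebra[OF C(1) f]) auto
      finally show ?thesis .
    qed
    have cl: "ha_eval C d t \<in> carrier C" for t
      using d by (intro heyting_algebra.eval_closed[OF C(1)]) auto
    \<comment> \<open>Injectivity of f carries the truth values of the atoms from C to the copy, and
      in C they are those in B.\<close>
    have "ha_sat ?C ?e \<theta> \<longleftrightarrow> ha_sat B e \<theta>"
    proof (rule quantifier_free_sat_cong[OF \<theta>(1)])
      fix s t assume "(s, t) \<in> atoms \<theta>"
      then have "(s, t) \<in> S" by (simp add: S_def)
      then show "ha_eval ?C (case_sum ?e id) s = ha_eval ?C (case_sum ?e id) t \<longleftrightarrow>
          ha_eval B (case_sum e id) s = ha_eval B (case_sum e id) t"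
        using vars[of s t] iff[of s t] by (simp add: ev inj_on_eq_iff[OF f] cl)
    qed
    moreover have "range ?e \<subseteq> carrier ?C"
      using d by (auto simp: image_algebra_def Let_def)
    ultimately show ?thesis using e(2) unfolding ha_satisfied_in_def by blast
  qed
  ultimately show ?thesis using \<theta>\<phi> by blast
qed

end
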